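(* Let $n>3$ be an integer, let $a\in\mathbb{C}$, and let $A$ be an $n\times n$ companion matrix whose spectrum consists of the single eigenvalue $a$ (that is, $A$ is the companion matrix of $p(z)=(z-a)^n$). If the numerical range $W(A)$ is a circular disk, then $a=0$, and hence $A=J_n$.
   Context: For an $n\times n$ complex matrix $A$, the numerical range is $W(A)=\{\langle Ax,x\rangle : x\in\mathbb{C}^n,\ \|x\|=1\}\subset\mathbb{C}$. The companion matrix of a monic polynomial $p(z)=z^n+a_1z^{n-1}+\cdots+a_{n-1}z+a_n$ is the $n\times n$ matrix with entries $1$ on the first superdiagonal, last row $(-a_n,-a_{n-1},\ldots,-a_2,-a_1)$, and all other entries $0$; its characteristic polynomial is $p(z)$. $J_n$ is the $n\times n$ nilpotent Jordan block (ones on the first superdiagonal, zeros elsewhere). A circular disk is a closed disk $\{z\in\mathbb{C}:|z-c|\le\lambda\}$ with $c\in\mathbb{C}$ and radius $\lambda>0$. *)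

theory Defs
  imports "HOL-Analysis.Analysis" "Jordan_Normal_Form.Spectral_Radius"
begin

text \<open>
  Indices are zero-based and \<open>n = degree p\<close>.  For the monic polynomial
  \<open>p = z^n + a_1 z^(n-1) + ... + a_n\<close> one has \<open>coeff p j = a_(n-j)\<close> for \<open>j < n\<close>, so the last row is
  \<open>(-a_n, -a_(n-1), ..., -a_1)\<close>.  Only meaningful for monic \<open>p\<close>.
\<close>
definition companion_mat :: "complex poly \<Rightarrow> complex mat" where
  "companion_mat p = mat (degree p) (degree p)
     (\<lambda>(i, j). if Suc i = degree p then - coeff p j else if Suc i = j then 1 else 0)"

definition euclid_norm :: "complex vec \<Rightarrow> real" where
  "euclid_norm x = sqrt (\<Sum>i<dim_vec x. (cmod (vec_index x i))\<^sup>2)"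

text \<open>
  The product \<open>v \<bullet>c w\<close> conjugates its second argument, so \<open>(A *\<^sub>v x) \<bullet>c x\<close> is the inner
  product of \<open>A x\<close> with \<open>x\<close>.  Intended for square matrices \<open>A\<close>.
\<close>
definition numerical_range :: "complex mat \<Rightarrow> complex set" where
  "numerical_range A =
     {(A *\<^sub>v x) \<bullet>c x | x. x \<in> carrier_vec (dim_col A) \<and> euclid_norm x = 1}"

definition circular_disk :: "complex set \<Rightarrow> bool" where
  "circular_disk S \<longleftrightarrow> (\<exists>c r. r > 0 \<and> S = cball c r)"

end

theory Submission
  imports Defs
begin

text \<open>
  Suppose \<open>W(A)\<close> is the disk with centre \<open>c\<close> and radius \<open>r\<close>, and put \<open>C = c - A\<close>.  In every direction \<open>w\<close>
  with \<open>\<bar>w\<bar> = 1\<close> the largest eigenvalue of the Hermitian part of \<open>w A\<close> is \<open>Re (w c) + r\<close>.  So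
  the matrix \<open>Re (w c) + r - Re (w A)\<close> is singular for all those \<open>w\<close>, and after multiplication by
  \<open>2 cnj w\<close> and a rescaling this says that the quadratic pencil \<open>C + s + C\<^sup>* s\<^sup>2 / (4 r\<^sup>2)\<close> is singular on a
  circle, hence identically (\<open>disk_numerical_range_pencil\<close>).  Its value at \<open>s = 0\<close> shows that
  \<open>c\<close> is an eigenvalue, so \<open>c = a\<close>.

  Now \<open>B = A - a\<close> is nilpotent of size \<open>n\<close>, so \<open>det (s - B) = s\<^sup>n\<close> and the adjugate of \<open>s - B\<close> is
  \<open>s\<^bsup>n-1\<^esup> + s\<^bsup>n-2\<^esup> B + \<dots> + B\<^bsup>n-1\<^esup>\<close>.  Expanding \<open>det (s - B - \<kappa> s\<^sup>2 B\<^sup>*)\<close> to first order in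
  \<open>\<kappa> s\<^sup>2\<close> gives \<open>s\<^sup>n - \<kappa> s\<^sup>2 tr (adj (s - B) B\<^sup>*) + O(s\<^sup>4)\<close>.  As \<open>n > 3\<close>, the coefficients of \<open>s\<^sup>2\<close> and
  \<open>s\<^sup>3\<close> come from the trace alone, so \<open>tr (B\<^bsup>n-1\<^esup> B\<^sup>*) = 0\<close> and \<open>tr (B\<^bsup>n-2\<^esup> B\<^sup>*) = 0\<close>
  (\<open>nilpotent_pencil_traces\<close>).

  For a companion matrix both traces are explicit, because \<open>f(A)\<close> is the matrix of multiplication
  by \<open>f\<close> modulo \<open>p = (x - a)\<^sup>n\<close>.  Writing \<open>S\<^sub>k\<close> for the sum over \<open>j < n\<close> of
  \<open>(k choose j) (n choose j) \<bar>a\<bar>\<^bsup>2(n-j)\<^esup>\<close>, the two conditions for \<open>a \<noteq> 0\<close> become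
  \<open>S\<^bsub>n-1\<^esub> = (-1)\<^bsup>n-1\<^esup>\<close> and \<open>S\<^bsub>n-2\<^esub> = (n + 1) (-1)\<^bsup>n-1\<^esup>\<close>.  The sums are nonnegative, so \<open>S\<^bsub>n-1\<^esub> = 1\<close> and
  \<open>S\<^bsub>n-2\<^esub> = n + 1\<close>, whereas \<open>S\<^bsub>n-2\<^esub> \<le> S\<^bsub>n-1\<^esub>\<close> (\<open>companion_traces_contradiction\<close>).
\<close>

section \<open>Numerical ranges that are disks\<close>

text \<open>
  The first variation of the form at a zero vanishes, since a zero is a minimum; varying in the
  direction \<open>G x\<close> yields \<open>\<parallel>G x\<parallel>\<^sup>2 = 0\<close>.
\<close>
lemma psd_form_null_vector:
  fixes G :: "nat \<Rightarrow> nat \<Rightarrow> complex"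
  assumes herm: "\<And>i j. i < n \<Longrightarrow> j < n \<Longrightarrow> G j i = cnj (G i j)"
    and psd: "\<And>y. 0 \<le> Re (\<Sum>i<n. \<Sum>j<n. G i j * y j * cnj (y i))"
    and null: "Re (\<Sum>i<n. \<Sum>j<n. G i j * x j * cnj (x i)) = 0"
    and "i < n"
  shows "(\<Sum>j<n. G i j * x j) = 0"
proof -
  define F where "F = (\<lambda>y z. \<Sum>i<n. \<Sum>j<n. G i j * y j * cnj (z i))"
  define z where "z = (\<lambda>i. \<Sum>j<n. G i j * x j)"
  define N where "N = (\<Sum>i<n. (cmod (z i))\<^sup>2)"
  have Fxz: "F x z = complex_of_real N"
    unfolding F_def N_def z_def sum_distrib_right[symmetric] of_real_sum
    by (rule sum.cong[OF refl]) (simp only: complex_norm_square)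
  have "F z x = (\<Sum>j<n. \<Sum>i<n. G i j * z j * cnj (x i))"
    unfolding F_def by (rule sum.swap)
  also have "\<dots> = cnj (F x z)"
    unfolding F_def cnj_sum
  proof (intro sum.cong refl)
    fix j i assume "j \<in> {..<n}" "i \<in> {..<n}"
    then have "G i j = cnj (G j i)" by (intro herm) auto
    then show "G i j * z j * cnj (x i) = cnj (G j i * x i * cnj (z j))"
      by (simp only: complex_cnj_mult complex_cnj_cnj mult_ac)
  qed
  finally have Fzx: "F z x = complex_of_real N" by (simp add: Fxz)
  have expand: "F (\<lambda>i. x i + of_real t * z i) (\<lambda>i. x i + of_real t * z i)
      = F x x + of_real t * (F x z + F z x) + of_real (t^2) * F z z" for t :: real
  proof -
    have "G i j * (x j + of_real t * z j) * cnj (x i + of_real t * z i) =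
        G i j * x j * cnj (x i) + of_real t * (G i j * x j * cnj (z i))
        + of_real t * (G i j * z j * cnj (x i)) + of_real (t^2) * (G i j * z j * cnj (z i))" for i j
      by (simp add: algebra_simps power2_eq_square)
    then show ?thesis
      unfolding F_def by (simp only: sum.distrib sum_distrib_left distrib_left add.assoc)
  qed
  have quad: "0 \<le> 2 * t * N + t\<^sup>2 * Re (F z z)" for t :: real
  proof -
    have "0 \<le> Re (F (\<lambda>i. x i + of_real t * z i) (\<lambda>i. x i + of_real t * z i))"
      unfolding F_def by (rule psd)
    also have "\<dots> = Re (F x x) + t * (N + N) + t\<^sup>2 * Re (F z z)"
      unfolding expand Fxz Fzx by (simp only: plus_complex.simps Re_complex_of_real times_complex.simps
          of_real_add[symmetric] of_real_mult[symmetric] Im_complex_of_real mult_zero_left diff_zero)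
    also have "Re (F x x) = 0" unfolding F_def by (rule null)
    finally show ?thesis by simp
  qed
  have "N \<ge> 0" unfolding N_def by (simp add: sum_nonneg)
  have "N = 0"
  proof (rule ccontr)
    assume "N \<noteq> 0"
    with \<open>N \<ge> 0\<close> have "N > 0" by simp
  \<comment> \<open>At \<open>t = - N / K\<close> the linear term of the quadratic outweighs the square term.\<close>
    define K where "K = \<bar>Re (F z z)\<bar> + 1"
    have K: "K > 0" "Re (F z z) < K" unfolding K_def by auto
    have "0 \<le> 2 * (- N / K) * N + (- N / K)\<^sup>2 * Re (F z z)" by (rule quad)
    also have "\<dots> \<le> 2 * (- N / K) * N + (- N / K)\<^sup>2 * K"
      using K by (intro add_left_mono mult_left_mono) auto
    also have "\<dots> = - (N\<^sup>2 / K)"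
      using K by (simp add: field_simps power2_eq_square)
    also have "\<dots> < 0" using \<open>N > 0\<close> K by simp
    finally show False by simp
  qed
  then have "(cmod (z i))\<^sup>2 = 0"
    using \<open>i < n\<close> unfolding N_def by (subst (asm) sum_nonneg_eq_0_iff) auto
  then show ?thesis by (simp add: z_def)
qed

text \<open>
  For \<open>w = cnj u\<close> the form of \<open>2 (Re (w c) + r) - w A - (w A)\<^sup>*\<close> is positive semidefinite, because no
  point of the disk exceeds \<open>Re (w c) + r\<close> in the direction \<open>w\<close>, and it has a nonzero zero, because
  the disk is closed.  The matrix in the statement is \<open>u\<close> times this one, which makes it polynomial
  in \<open>u\<close>.
\<close>
lemma disk_numerical_range_pencil_singular:
  assumes A: "A \<in> carrier_mat n n" and "r > 0"
    and W: "numerical_range A = cball c r"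
    and u: "cmod u = 1"
  shows "det (mat n n (\<lambda>(i, j). (if i = j then 2 * of_real r * u + c + u\<^sup>2 * cnj c else 0)
      - A $$ (i, j) - u\<^sup>2 * cnj (A $$ (j, i)))) = 0" (is "det ?M = 0")
proof -
  have uw: "u * cnj u = 1"
    using u by (metis complex_norm_square of_real_1 one_power2)
  define w where "w = cnj u"
  have w: "cmod w = 1" "w * cnj w = 1" "u * w = 1"
    using u uw by (auto simp: w_def mult.commute)
  define \<mu> where "\<mu> = Re (w * c) + r"
  define form where "form = (\<lambda>y. \<Sum>i<n. \<Sum>j<n. A $$ (i, j) * y j * cnj (y i))"
  define nsq where "nsq = (\<lambda>y :: nat \<Rightarrow> complex. \<Sum>i<n. (cmod (y i))\<^sup>2)"
  have quad: "(A *\<^sub>v vec n y) \<bullet>c vec n y = form y" for y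
    using A unfolding form_def scalar_prod_def
    by (auto simp: scalar_prod_def sum_distrib_right lessThan_atLeast0 intro!: sum.cong)
  have bound: "Re (w * form y) \<le> \<mu> * nsq y" for y
  proof (cases "nsq y = 0")
    case True
    then have "\<forall>i<n. y i = 0"
      unfolding nsq_def by (subst (asm) sum_nonneg_eq_0_iff) auto
    then show ?thesis using True by (simp add: form_def)
  next
    case False
    have nsq0: "nsq y > 0"
      using False unfolding nsq_def by (metis sum_nonneg zero_le_power2 less_eq_real_def)
    define \<nu> where "\<nu> = sqrt (nsq y)"
    have \<nu>: "\<nu> > 0" "\<nu>\<^sup>2 = nsq y" using nsq0 by (auto simp: \<nu>_def)
    define y' where "y' = (\<lambda>i. y i / of_real \<nu>)"
    have "nsq y' = nsq y / \<nu>\<^sup>2"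
      using \<nu>(1) unfolding nsq_def y'_def
      by (simp add: norm_divide power_divide sum_divide_distrib)
    then have "euclid_norm (vec n y') = 1"
      using \<nu> nsq0 unfolding euclid_norm_def nsq_def by simp
    then have "form y' \<in> cball c r"
      using A unfolding W[symmetric] numerical_range_def quad[symmetric] by auto
    then have "cmod (w * (form y' - c)) \<le> r"
      using w by (simp add: norm_mult dist_norm norm_minus_commute)
    then have "Re (w * form y') \<le> \<mu>"
      unfolding \<mu>_def using complex_Re_le_cmod[of "w * (form y' - c)"]
      by (simp add: algebra_simps)
    moreover have "form y = of_real (nsq y) * form y'"
      using \<nu>(1) unfolding form_def y'_def \<nu>(2)[symmetric]
      by (simp add: sum_distrib_left power2_eq_square)
    ultimately have "Re (w * form y) = nsq y * Re (w * form y')"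
      by (simp add: algebra_simps)
    then show ?thesis
      using nsq0 \<open>Re (w * form y') \<le> \<mu>\<close> by (simp only: mult.commute[of \<mu>] mult_left_mono less_imp_le)
  qed
  \<comment> \<open>This boundary point is where \<open>Re (w z)\<close> attains its maximum \<open>\<mu>\<close> over the disk.\<close>
  have "c + of_real r * cnj w \<in> numerical_range A"
    using w \<open>r > 0\<close> by (simp add: W dist_norm norm_mult)
  then obtain v where v: "v \<in> carrier_vec n" "euclid_norm v = 1"
    and fv: "(A *\<^sub>v v) \<bullet>c v = c + of_real r * cnj w"
    using A unfolding numerical_range_def by auto
  define x where "x = (\<lambda>i. vec_index v i)"
  have vx: "v = vec n x" using v by (auto simp: x_def)
  have formx: "form x = c + of_real r * cnj w" using fv quad by (simp add: vx)
  have nsqx: "nsq x = 1"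
    using v unfolding nsq_def x_def euclid_norm_def by simp
  \<comment> \<open>Twice the matrix \<open>\<mu> - Re (w A)\<close>, where \<open>Re\<close> is the Hermitian part.\<close>
  define G where "G = (\<lambda>i j. (if i = j then 2 * of_real \<mu> else 0) - w * A $$ (i, j) - cnj (w * A $$ (j, i)))"
  have Gform: "Re (\<Sum>i<n. \<Sum>j<n. G i j * y j * cnj (y i)) = 2 * (\<mu> * nsq y - Re (w * form y))" for y
  proof -
    have "(\<Sum>i<n. \<Sum>j<n. G i j * y j * cnj (y i))
      = (\<Sum>i<n. \<Sum>j<n. (if i = j then 2 * of_real \<mu> * y j * cnj (y i) else 0))
        - (\<Sum>i<n. \<Sum>j<n. w * A $$ (i, j) * y j * cnj (y i))
        - (\<Sum>i<n. \<Sum>j<n. cnj (w * A $$ (j, i)) * y j * cnj (y i))"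
      unfolding G_def sum_subtractf[symmetric]
      by (intro sum.cong refl) (auto simp: algebra_simps)
    also have "(\<Sum>i<n. \<Sum>j<n. (if i = j then 2 * of_real \<mu> * y j * cnj (y i) else 0))
        = of_real (2 * \<mu> * nsq y)"
      unfolding nsq_def by (simp add: sum_distrib_left complex_norm_square mult_ac del: of_real_power)
    also have "(\<Sum>i<n. \<Sum>j<n. w * A $$ (i, j) * y j * cnj (y i)) = w * form y"
      unfolding form_def by (simp add: sum_distrib_left mult_ac)
    also have "(\<Sum>i<n. \<Sum>j<n. cnj (w * A $$ (j, i)) * y j * cnj (y i)) = cnj (w * form y)"
      unfolding form_def by (subst sum.swap) (simp add: sum_distrib_left mult_ac)
    finally show ?thesis by simp
  qed
  have null: "(\<Sum>j<n. G i j * x j) = 0" if "i < n" for i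
  proof (rule psd_form_null_vector[OF _ _ _ that])
    show "G j i = cnj (G i j)" for i j by (auto simp: G_def)
    show "0 \<le> Re (\<Sum>i<n. \<Sum>j<n. G i j * y j * cnj (y i))" for y
      unfolding Gform using bound[of y] by (intro mult_nonneg_nonneg) (simp_all only: diff_ge_0_iff_ge zero_le_numeral)
    have "w * form x = w * c + of_real r * (w * cnj w)"
      unfolding formx by (simp add: algebra_simps)
    then have "Re (w * form x) = \<mu>"
      unfolding w(2) \<mu>_def by simp
    then show "Re (\<Sum>i<n. \<Sum>j<n. G i j * x j * cnj (x i)) = 0"
      unfolding Gform nsqx by (simp only: mult_1_right diff_self mult_zero_right)
  qed
  define M where "M = ?M"
  have M: "M \<in> carrier_mat n n" by (simp add: M_def)
  have Gu: "M $$ (i, j) = u * G i j" if "i < n" "j < n" for i j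
  proof -
    have \<mu>2: "2 * complex_of_real \<mu> = w * c + u * cnj c + 2 * of_real r"
    proof -
      have "u = cnj w" by (simp add: w_def)
      then show ?thesis
        unfolding \<mu>_def by (auto simp: complex_eq_iff)
    qed
    have uwq: "u * (w * q) = q" for q
      using w(3) by (simp add: mult.assoc[symmetric])
    have "u * G i j = (if i = j then u * (2 * of_real \<mu>) else 0) - u * (w * A $$ (i, j))
        - u * (u * cnj (A $$ (j, i)))"
      by (simp add: G_def w_def right_diff_distrib)
    also have "u * (2 * of_real \<mu>) = 2 * of_real r * u + c + u\<^sup>2 * cnj c"
      unfolding \<mu>2 distrib_left uwq by (simp add: power2_eq_square)
    finally show ?thesis
      using that unfolding uwq by (simp add: M_def power2_eq_square)
  qed
  have "M *\<^sub>v v = 0\<^sub>v n"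
  proof (rule eq_vecI)
    fix i assume "i < dim_vec (0\<^sub>v n :: complex vec)"
    then have i: "i < n" by simp
    have "vec_index (M *\<^sub>v v) i = (\<Sum>j<n. M $$ (i, j) * x j)"
      using i v M by (simp add: scalar_prod_def lessThan_atLeast0 x_def)
    also have "\<dots> = (\<Sum>j<n. u * G i j * x j)"
      using i by (intro sum.cong refl) (simp add: Gu)
    also have "\<dots> = u * (\<Sum>j<n. G i j * x j)"
      by (simp add: sum_distrib_left mult.assoc)
    finally show "vec_index (M *\<^sub>v v) i = vec_index (0\<^sub>v n) i" using null[OF i] i by simp
  qed (use M in simp)
  moreover have "v \<noteq> 0\<^sub>v n"
    using v by (auto simp: euclid_norm_def)
  ultimately have "det M = 0"
    using v M by (subst det_0_iff_vec_prod_zero[where n = n]) auto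
  then show ?thesis by (simp only: M_def)
qed

text \<open>
  A determinant that is polynomial in \<open>s\<close> and vanishes on a circle is zero.  The substitution
  \<open>s = 2 r u\<close> normalises the linear coefficient to the identity matrix, so that the pencil becomes a
  perturbation of a characteristic matrix.
\<close>
lemma disk_numerical_range_pencil:
  assumes A: "A \<in> carrier_mat n n" and "r > 0"
    and W: "numerical_range A = cball c r"
  defines "C \<equiv> c \<cdot>\<^sub>m 1\<^sub>m n - A"
  shows "det (mat n n (\<lambda>(i, j). [:C $$ (i, j), if i = j then 1 else 0,
      cnj (C $$ (j, i)) / (4 * of_real r ^ 2):])) = 0" (is "det ?P = 0")
proof -
  define P where "P = ?P"
  have P: "P \<in> carrier_mat n n" by (simp add: P_def)
  have "poly (det P) s = 0" if s: "s \<in> sphere 0 (2 * r)" for s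
  proof -
    define u where "u = s / (2 * of_real r)"
    have su: "s = 2 * of_real r * u" using \<open>r > 0\<close> by (simp add: u_def)
    have "cmod u = 1"
      using s \<open>r > 0\<close> by (simp add: u_def norm_divide norm_mult)
    define M where "M = mat n n (\<lambda>(i, j). (if i = j then 2 * of_real r * u + c + u\<^sup>2 * cnj c else 0)
      - A $$ (i, j) - u\<^sup>2 * cnj (A $$ (j, i)))"
    have "poly (det P) s = det M"
    proof (rule poly_det_cong[OF _ P])
      fix i j assume ij: "i < n" "j < n"
      have "s * s / (4 * of_real r ^ 2) = u\<^sup>2"
        unfolding su using \<open>r > 0\<close> by (simp add: field_simps power2_eq_square)
      then have "s * (s * (z / (4 * of_real r ^ 2))) = u\<^sup>2 * z" for z
        by (metis mult.assoc times_divide_eq_left times_divide_eq_right)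
      then show "poly (P $$ (i, j)) s = M $$ (i, j)"
        using ij A by (auto simp: P_def M_def C_def su[symmetric] distrib_left right_diff_distrib diff_divide_distrib)
    qed (simp add: M_def)
    also have "\<dots> = 0"
      unfolding M_def
      by (rule disk_numerical_range_pencil_singular[OF A \<open>r > 0\<close> W \<open>cmod u = 1\<close>])
    finally show ?thesis .
  qed
  then have "sphere 0 (2 * r) \<subseteq> {s. poly (det P) s = 0}" by auto
  moreover have "infinite (sphere (0 :: complex) (2 * r))"
  proof -
    have "connected (sphere (0 :: complex) (2 * r))"
      by (rule connected_sphere) simp
    moreover have "complex_of_real (2 * r) \<in> sphere 0 (2 * r)" "- complex_of_real (2 * r) \<in> sphere 0 (2 * r)"
      using \<open>r > 0\<close> by (auto simp: norm_mult)
    moreover have "complex_of_real (2 * r) \<noteq> - complex_of_real (2 * r)"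
      using \<open>r > 0\<close> by (simp add: complex_eq_iff)
    ultimately show ?thesis
      using connected_finite_iff_sing[of "sphere (0 :: complex) (2 * r)"] by (metis empty_iff singletonD)
  qed
  ultimately have "infinite {s. poly (det P) s = 0}"
    using finite_subset by blast
  then have "det P = 0"
    using poly_roots_finite by blast
  then show ?thesis by (simp only: P_def)
qed

lemma disk_numerical_range_center_eigenvalue:
  assumes A: "A \<in> carrier_mat n n" and "r > 0"
    and W: "numerical_range A = cball c r"
  shows "eigenvalue A c"
proof -
  define C where "C = c \<cdot>\<^sub>m 1\<^sub>m n - A"
  have C: "C \<in> carrier_mat n n" using A unfolding C_def by (intro minus_carrier_mat)
  have "0 = poly (det (mat n n (\<lambda>(i, j). [:C $$ (i, j), if i = j then 1 else 0,
      cnj (C $$ (j, i)) / (4 * of_real r ^ 2):]))) 0"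
    unfolding C_def disk_numerical_range_pencil[OF assms] by simp
  also have "\<dots> = det C"
    by (rule poly_det_cong[OF C]) auto
  finally have "det C = 0" ..
  moreover have "C = - char_matrix A c"
    using A by (intro eq_matI) (auto simp: C_def char_matrix_def)
  ultimately show ?thesis
    using A by (simp add: eigenvalue_det det_0_negate[of _ n])
qed

section \<open>Quadratic perturbations of nilpotent matrices\<close>

lemma monic_complex_poly_single_root:
  fixes p :: "complex poly"
  assumes "monic p" and roots: "\<And>z. poly p z = 0 \<Longrightarrow> z = a"
  shows "p = [:- a, 1:] ^ degree p"
proof (cases "degree p = 0")
  case True
  then show ?thesis
    using assms(1) by (metis monic_degree_0 power_0)
next
  case False
  then obtain z where "poly p z = 0"
    using fundamental_theorem_of_algebra[of p] by (auto simp: constant_degree)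
  then have "{z. poly p z = 0} = {a}"
    using roots by auto
  then have p: "p = [:- a, 1:] ^ order a p"
    using complex_poly_decompose[of p] \<open>monic p\<close> by simp
  have "degree p = order a p"
    by (subst p) (simp add: degree_linear_power)
  then show ?thesis using p by simp
qed

text \<open>
  Jacobi's formula, in the form that follows from the product rule and Laplace expansion along
  the differentiated row.
\<close>
lemma pderiv_det:
  fixes M :: "'a :: idom poly mat"
  assumes M: "M \<in> carrier_mat n n"
  shows "pderiv (det M) = (\<Sum>i<n. \<Sum>j<n. pderiv (M $$ (i, j)) * cofactor M i j)"
proof -
  define D where "D = (\<lambda>a. mat n n (\<lambda>(i, j). if i = a then pderiv (M $$ (i, j)) else M $$ (i, j)))"
  have D: "D a \<in> carrier_mat n n" for a by (simp add: D_def)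
  let ?P = "{\<pi>. \<pi> permutes {0..<n}}"
  have sgn: "pderiv (signof \<pi> * q) = signof \<pi> * pderiv q" for \<pi> :: "nat \<Rightarrow> nat" and q :: "'a poly"
    by (cases \<pi> rule: sign_cases) (simp_all add: pderiv_minus)
  have "pderiv (det M) = (\<Sum>\<pi>\<in>?P. signof \<pi> * (\<Sum>a<n.
      (\<Prod>i\<in>{0..<n} - {a}. M $$ (i, \<pi> i)) * pderiv (M $$ (a, \<pi> a))))"
    unfolding det_def'[OF M] pderiv_sum sgn pderiv_prod lessThan_atLeast0 ..
  also have "\<dots> = (\<Sum>a<n. \<Sum>\<pi>\<in>?P. signof \<pi> *
      ((\<Prod>i\<in>{0..<n} - {a}. M $$ (i, \<pi> i)) * pderiv (M $$ (a, \<pi> a))))"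
    unfolding sum_distrib_left by (rule sum.swap)
  also have "\<dots> = (\<Sum>a<n. det (D a))"
  proof (rule sum.cong[OF refl])
    fix a assume "a \<in> {..<n}"
    then have a: "a \<in> {0..<n}" by simp
    show "(\<Sum>\<pi>\<in>?P. signof \<pi> *
        ((\<Prod>i\<in>{0..<n} - {a}. M $$ (i, \<pi> i)) * pderiv (M $$ (a, \<pi> a)))) = det (D a)"
      unfolding det_def'[OF D]
    proof (rule sum.cong[OF refl])
      fix \<pi> assume "\<pi> \<in> ?P"
      then have \<pi>: "\<pi> i < n" if "i < n" for i
        using that permutes_in_image[of \<pi> "{0..<n}" i] by simp
      have "(\<Prod>i = 0..<n. D a $$ (i, \<pi> i))
          = D a $$ (a, \<pi> a) * (\<Prod>i\<in>{0..<n} - {a}. D a $$ (i, \<pi> i))"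
        by (rule prod.remove) (use a in auto)
      also have "D a $$ (a, \<pi> a) = pderiv (M $$ (a, \<pi> a))"
        using a \<pi> by (simp add: D_def)
      also have "(\<Prod>i\<in>{0..<n} - {a}. D a $$ (i, \<pi> i)) = (\<Prod>i\<in>{0..<n} - {a}. M $$ (i, \<pi> i))"
        using \<pi> by (intro prod.cong refl) (simp add: D_def)
      finally show "signof \<pi> * ((\<Prod>i\<in>{0..<n} - {a}. M $$ (i, \<pi> i)) * pderiv (M $$ (a, \<pi> a)))
          = signof \<pi> * (\<Prod>i = 0..<n. D a $$ (i, \<pi> i))"
        by (simp only: mult.commute)
    qed
  qed
  also have "\<dots> = (\<Sum>i<n. \<Sum>j<n. pderiv (M $$ (i, j)) * cofactor M i j)"
  proof (rule sum.cong[OF refl])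
    fix a assume "a \<in> {..<n}"
    then have a: "a < n" by simp
    have "mat_delete (D a) a j = mat_delete M a j" for j
      using M by (intro eq_matI) (auto simp: mat_delete_def D_def)
    then show "det (D a) = (\<Sum>j<n. pderiv (M $$ (a, j)) * cofactor M a j)"
      unfolding laplace_expansion_row[OF D a] cofactor_def
      using a by (intro sum.cong refl) (simp add: D_def)
  qed
  finally show ?thesis .
qed

lemma pow_mat_Suc_left:
  assumes N: "N \<in> carrier_mat n n"
  shows "N ^\<^sub>m Suc k = N * N ^\<^sub>m k"
proof (induction k)
  case (Suc k)
  have Nk: "N ^\<^sub>m k \<in> carrier_mat n n" using N by simp
  show ?case
    using Suc.IH assoc_mult_mat[OF N Nk N] by simp
qed (use N in simp)

lemma char_poly_nilpotent:
  fixes N :: "complex mat"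
  assumes N: "N \<in> carrier_mat n n" and nil: "N ^\<^sub>m k = 0\<^sub>m n n"
  shows "char_poly N = monom 1 n"
proof -
  have "degree (char_poly N) = n" "monic (char_poly N)"
    using degree_monic_char_poly[OF N] by auto
  moreover have "z = 0" if "poly (char_poly N) z = 0" for z
  proof -
    from that obtain v where v: "eigenvector N v z"
      unfolding eigenvalue_root_char_poly[OF N, symmetric] eigenvalue_def by blast
    then have vn: "v \<in> carrier_vec n" "v \<noteq> 0\<^sub>v n"
      using N by (auto simp: eigenvector_def)
    have "0\<^sub>m n n *\<^sub>v v = 0\<^sub>v n"
      using vn by (intro eq_vecI) (auto simp: scalar_prod_def)
    then have "z ^ k \<cdot>\<^sub>v v = 0\<^sub>v n"
      using eigenvector_pow[OF N v, of k] nil by simp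
    moreover obtain i where "i < n" "vec_index v i \<noteq> 0"
      using vn by (metis carrier_vecD eq_vecI index_zero_vec(1,2))
    ultimately have "z ^ k = 0"
      using vn by (metis carrier_vecD index_smult_vec(1) index_zero_vec(1) mult_eq_0_iff)
    then show "z = 0" by simp
  qed
  ultimately have "char_poly N = [:- 0, 1:] ^ n"
    using monic_complex_poly_single_root[of "char_poly N" 0] by metis
  then show ?thesis by (simp add: monom_altdef)
qed

text \<open>
  The finite geometric series for \<open>s\<^sup>n (s - N)\<^bsup>-1\<^esup>\<close>; here \<open>det (s - N) = s\<^sup>n\<close>.
\<close>
lemma adj_char_poly_matrix_nilpotent:
  fixes N :: "complex mat"
  assumes N: "N \<in> carrier_mat n n" and nil: "N ^\<^sub>m n = 0\<^sub>m n n" and ij: "i < n" "j < n"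
  shows "adj_mat (char_poly_matrix N) $$ (i, j) = (\<Sum>k<n. monom ((N ^\<^sub>m k) $$ (i, j)) (n - 1 - k))"
proof -
  define X where "X = char_poly_matrix N"
  define R where "R = mat n n (\<lambda>(i, j). \<Sum>k<n. monom ((N ^\<^sub>m k) $$ (i, j)) (n - 1 - k))"
  have X: "X \<in> carrier_mat n n" and R: "R \<in> carrier_mat n n"
    using N by (simp_all add: X_def R_def)
  have Pk: "N ^\<^sub>m k \<in> carrier_mat n n" for k using N by simp
  have det: "det X = monom 1 n"
    using char_poly_nilpotent[OF N nil] by (simp add: X_def char_poly_def)
  have XR: "X * R = monom 1 n \<cdot>\<^sub>m 1\<^sub>m n"
  proof (rule eq_matI)
    fix i j assume "i < dim_row (monom 1 n \<cdot>\<^sub>m 1\<^sub>m n :: complex poly mat)"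
      and "j < dim_col (monom 1 n \<cdot>\<^sub>m 1\<^sub>m n :: complex poly mat)"
    then have i: "i < n" and j: "j < n" by auto
    define b where "b = (\<lambda>k. monom ((N ^\<^sub>m k) $$ (i, j)) (n - k))"
    have "(X * R) $$ (i, j) = (\<Sum>l<n. X $$ (i, l) * R $$ (l, j))"
      using X R i j by (simp add: scalar_prod_def lessThan_atLeast0)
    also have "\<dots> = (\<Sum>l<n. (if i = l then [:0, 1:] * R $$ (l, j) else 0) + [:- N $$ (i, l):] * R $$ (l, j))"
      using N i by (intro sum.cong refl) (simp add: X_def char_poly_matrix_def algebra_simps)
    also have "\<dots> = [:0, 1:] * R $$ (i, j) + (\<Sum>l<n. [:- N $$ (i, l):] * R $$ (l, j))"
      unfolding sum.distrib using i by simp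
    also have "[:0, 1:] * R $$ (i, j) = (\<Sum>k<n. b k)"
      using i j by (simp add: R_def b_def pCons_0_as_mult sum_distrib_left Suc_diff_Suc monom_Suc[symmetric]
          flip: pCons_0_as_mult)
    also have "(\<Sum>l<n. [:- N $$ (i, l):] * R $$ (l, j)) = (\<Sum>k<n. - b (Suc k))"
    proof -
      have "(\<Sum>l<n. [:- N $$ (i, l):] * R $$ (l, j))
          = (\<Sum>l<n. \<Sum>k<n. monom (- (N $$ (i, l) * (N ^\<^sub>m k) $$ (l, j))) (n - 1 - k))"
        using j by (intro sum.cong refl) (simp add: R_def sum_distrib_left smult_monom smult_sum2)
      also have "\<dots> = (\<Sum>k<n. \<Sum>l<n. monom (- (N $$ (i, l) * (N ^\<^sub>m k) $$ (l, j))) (n - 1 - k))"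
        by (rule sum.swap)
      also have "\<dots> = (\<Sum>k<n. - b (Suc k))"
      proof (intro sum.cong refl)
        fix k
        have "(N ^\<^sub>m Suc k) $$ (i, j) = (\<Sum>l<n. N $$ (i, l) * (N ^\<^sub>m k) $$ (l, j))"
          unfolding pow_mat_Suc_left[OF N] using N Pk[of k] i j
          by (simp add: scalar_prod_def lessThan_atLeast0)
        then show "(\<Sum>l<n. monom (- (N $$ (i, l) * (N ^\<^sub>m k) $$ (l, j))) (n - 1 - k)) = - b (Suc k)"
          unfolding b_def by (simp add: monom_sum[symmetric] sum_negf minus_monom del: pow_mat.simps)
      qed
      finally show ?thesis .
    qed
    also have "(\<Sum>k<n. b k) + (\<Sum>k<n. - b (Suc k)) = b 0 - b n"
      using sum_lessThan_telescope'[of b n] by (simp add: sum_subtractf sum_negf)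
    also have "\<dots> = (monom 1 n \<cdot>\<^sub>m 1\<^sub>m n) $$ (i, j)"
      using i j nil N by (simp add: b_def)
    finally show "(X * R) $$ (i, j) = (monom 1 n \<cdot>\<^sub>m 1\<^sub>m n) $$ (i, j)" .
  qed (use X R in auto)
  \<comment> \<open>Both \<open>R\<close> and the adjugate are \<open>monom 1 n\<close> times an inverse of \<open>X\<close>, and \<open>monom 1 n\<close> can be cancelled.\<close>
  note adj = adj_mat[OF X, unfolded det]
  have "monom 1 n \<cdot>\<^sub>m R = (adj_mat X * X) * R"
    unfolding adj(3) using R by (simp add: mult_smult_assoc_mat[of _ n n])
  also have "\<dots> = adj_mat X * (X * R)"
    by (rule assoc_mult_mat[OF adj(1) X R])
  also have "\<dots> = monom 1 n \<cdot>\<^sub>m adj_mat X"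
    unfolding XR using mult_smult_distrib[OF adj(1) one_carrier_mat] adj(1) by simp
  finally have "(monom 1 n \<cdot>\<^sub>m R) $$ (i, j) = (monom 1 n \<cdot>\<^sub>m adj_mat X) $$ (i, j)"
    by simp
  then show ?thesis
    using ij adj(1) R by (simp add: R_def X_def)
qed

text \<open>
  Replace \<open>s\<^sup>2\<close> in front of \<open>Q\<close> by an independent variable \<open>\<epsilon>\<close>.  The determinant is then
  \<open>s\<^sup>n - \<epsilon> tr (adj (s - N) Q) + \<epsilon>\<^sup>2 h\<close> with \<open>h\<close> polynomial, so setting \<open>\<epsilon> = s\<^sup>2\<close> forces the trace to
  vanish modulo \<open>s\<^sup>2\<close>.
\<close>
lemma nilpotent_pencil_traces:
  fixes N Q :: "complex mat"
  assumes N: "N \<in> carrier_mat n n" and Q: "Q \<in> carrier_mat n n"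
    and nil: "N ^\<^sub>m n = 0\<^sub>m n n" and "n > 3" and "k < 2"
    and sing: "det (mat n n (\<lambda>(i, j). char_poly_matrix N $$ (i, j) - [:0, 0, Q $$ (i, j):])) = 0"
  shows "(\<Sum>i<n. \<Sum>j<n. Q $$ (i, j) * (N ^\<^sub>m (n - 1 - k)) $$ (j, i)) = 0"
proof -
  define X where "X = char_poly_matrix N"
  have X: "X \<in> carrier_mat n n" using N by (simp add: X_def)
  define M where "M = mat n n (\<lambda>(i, j). [:X $$ (i, j), - [:Q $$ (i, j):]:])"
  have M: "M \<in> carrier_mat n n" by (simp add: M_def)
  have M0: "poly (M $$ (i, j)) 0 = X $$ (i, j)" if "i < n" "j < n" for i j
    using that by (simp add: M_def)
  define q :: "complex poly" where "q = [:0, 0, 1:]"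
  define g where "g = (\<Sum>i<n. \<Sum>j<n. Polynomial.smult (Q $$ (i, j)) (adj_mat X $$ (j, i)))"
  have D0: "poly (det M) 0 = monom 1 n"
  proof -
    have "poly (det M) 0 = det X"
      by (rule poly_det_cong[OF X M]) (rule M0)
    also have "\<dots> = monom 1 n"
      using char_poly_nilpotent[OF N nil] by (simp add: X_def char_poly_def)
    finally show ?thesis .
  qed
  have Dq: "poly (det M) q = 0"
  proof -
    have "poly (det M) q = det (mat n n (\<lambda>(i, j). X $$ (i, j) - [:0, 0, Q $$ (i, j):]))"
      by (rule poly_det_cong[OF _ M]) (simp_all add: M_def q_def)
    then show ?thesis using sing by (simp add: X_def)
  qed
  have D1: "poly (pderiv (det M)) 0 = - g"
  proof -
    have "poly (pderiv (M $$ (i, j)) * cofactor M i j) 0 = - Polynomial.smult (Q $$ (i, j)) (adj_mat X $$ (j, i))"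
      if ij: "i < n" "j < n" for i j
    proof -
      have "poly (det (mat_delete M i j)) 0 = det (mat_delete X i j)"
      proof (rule poly_det_cong[where n = "n - 1"])
        fix i' j' assume "i' < n - 1" "j' < n - 1"
        then show "poly (mat_delete M i j $$ (i', j')) 0 = mat_delete X i j $$ (i', j')"
          using M X by (auto simp: mat_delete_def intro!: M0)
      qed (use M X in \<open>auto simp: mat_delete_def\<close>)
      then have "poly (cofactor M i j) 0 = cofactor X i j"
        by (simp add: cofactor_def poly_power)
      then show ?thesis
        using ij X by (simp add: M_def pderiv_pCons adj_mat_def)
    qed
    then show ?thesis
      unfolding pderiv_det[OF M] g_def poly_sum sum_negf[symmetric]
      by (intro sum.cong refl) auto
  qed
  obtain f0 f1 h where D: "det M = pCons f0 (pCons f1 h)"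
    by (metis pCons_cases)
  have f: "f0 = monom 1 n" "f1 = - g"
    using D0 D1 unfolding D by (simp_all add: pderiv_pCons)
  have "q * (monom 1 (n - 2) - g + q * poly h q) = 0"
  proof -
    have "q = monom 1 2" by (simp add: q_def monom_altdef power2_eq_square)
    moreover have "2 + (n - 2) = n" using \<open>n > 3\<close> by linarith
    ultimately have "q * monom 1 (n - 2) = monom 1 n"
      by (simp only: mult_monom mult_1)
    then show ?thesis
      using Dq unfolding D f by (simp add: algebra_simps)
  qed
  moreover have "q \<noteq> 0" by (simp add: q_def)
  ultimately have "monom 1 (n - 2) - g + q * poly h q = 0"
    by (simp only: mult_eq_0_iff) simp
  then have "g = monom 1 (n - 2) + q * poly h q"
    by (simp add: algebra_simps)
  \<comment> \<open>This is where \<open>n > 3\<close> enters: \<open>monom 1 (n - 2)\<close> has no coefficient below degree 2.\<close>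
  then have "coeff g k = 0"
    using \<open>k < 2\<close> \<open>n > 3\<close> by (cases k) (auto simp: q_def coeff_pCons split: nat.splits)
  moreover have "coeff (adj_mat X $$ (j, i)) k = (N ^\<^sub>m (n - 1 - k)) $$ (j, i)" if "i < n" "j < n" for i j
  proof -
    have "coeff (adj_mat X $$ (j, i)) k = (\<Sum>l<n. if l = n - 1 - k then (N ^\<^sub>m l) $$ (j, i) else 0)"
      unfolding X_def adj_char_poly_matrix_nilpotent[OF N nil that(2,1)] coeff_sum
      using \<open>k < 2\<close> \<open>n > 3\<close> by (intro sum.cong refl) auto
    then show ?thesis using \<open>n > 3\<close> by simp
  qed
  ultimately show ?thesis
    unfolding g_def by (simp add: coeff_sum)
qed

section \<open>Companion matrices as multiplication modulo a polynomial\<close>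

definition mult_mod_mat :: "complex poly \<Rightarrow> complex poly \<Rightarrow> complex mat" where
  "mult_mod_mat p f = mat (degree p) (degree p) (\<lambda>(i, j). coeff ((monom 1 i * f) mod p) j)"

lemma mult_mod_mat_carrier [simp]: "mult_mod_mat p f \<in> carrier_mat (degree p) (degree p)"
  by (simp add: mult_mod_mat_def)

lemma mult_mod_mat_one: "mult_mod_mat p 1 = 1\<^sub>m (degree p)"
  by (rule eq_matI) (auto simp: mult_mod_mat_def mod_poly_less degree_monom_eq)

lemma sum_mod_poly:
  fixes p :: "complex poly"
  shows "(\<Sum>x\<in>X. f x) mod p = (\<Sum>x\<in>X. f x mod p)"
  by (induction X rule: infinite_finite_induct) (simp_all add: poly_mod_add_left)

text \<open>
  Row \<open>i\<close> of \<open>mult_mod_mat p f\<close> represents \<open>x\<^sup>i f\<close> modulo \<open>p\<close> in the basis of the powers of \<open>x\<close>, so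
  the product is composition of multiplication maps.
\<close>
lemma mult_mod_mat_mult:
  assumes "degree p > 0"
  shows "mult_mod_mat p f * mult_mod_mat p g = mult_mod_mat p (f * g)"
proof (rule eq_matI)
  fix i j assume "i < dim_row (mult_mod_mat p (f * g))" "j < dim_col (mult_mod_mat p (f * g))"
  then have ij: "i < degree p" "j < degree p" by (simp_all add: mult_mod_mat_def)
  define h where "h = (monom 1 i * f) mod p"
  have "p \<noteq> 0" using assms by auto
  then have "degree h < degree p"
    using assms degree_mod_less'[of p "monom 1 i * f"] unfolding h_def
    by (cases "(monom 1 i * f) mod p = 0") auto
  then have "degree h \<le> degree p - 1" by simp
  then have h: "h = (\<Sum>l<degree p. monom (coeff h l) l)"
    using poly_as_sum_of_monoms'[of h "degree p - 1"] assms
    by (simp flip: lessThan_Suc_atMost)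
  have "(mult_mod_mat p f * mult_mod_mat p g) $$ (i, j)
      = (\<Sum>l<degree p. coeff h l * coeff ((monom 1 l * g) mod p) j)"
    using ij by (simp add: mult_mod_mat_def scalar_prod_def lessThan_atLeast0 h_def)
  also have "\<dots> = coeff ((\<Sum>l<degree p. Polynomial.smult (coeff h l) (monom 1 l * g)) mod p) j"
    by (simp add: sum_mod_poly coeff_sum mod_smult_left)
  also have "(\<Sum>l<degree p. Polynomial.smult (coeff h l) (monom 1 l * g)) = h * g"
    by (subst (2) h) (simp add: sum_distrib_right smult_monom flip: mult_smult_left)
  also have "(h * g) mod p = (monom 1 i * (f * g)) mod p"
    by (simp add: h_def mod_mult_left_eq mult.assoc)
  finally show "(mult_mod_mat p f * mult_mod_mat p g) $$ (i, j) = mult_mod_mat p (f * g) $$ (i, j)"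
    using ij by (simp add: mult_mod_mat_def)
qed (simp_all add: mult_mod_mat_def)

lemma mult_mod_mat_power:
  assumes "degree p > 0"
  shows "mult_mod_mat p f ^\<^sub>m k = mult_mod_mat p (f ^ k)"
proof (induction k)
  case 0
  then show ?case by (simp add: mult_mod_mat_one) (simp add: mult_mod_mat_def)
next
  case (Suc k)
  then show ?case by (simp add: mult_mod_mat_mult[OF assms] mult.commute)
qed

lemma companion_mat_shift:
  assumes "monic p" and "degree p > 0"
  shows "companion_mat p - a \<cdot>\<^sub>m 1\<^sub>m (degree p) = mult_mod_mat p [:- a, 1:]"
proof (rule eq_matI)
  fix i j assume "i < dim_row (mult_mod_mat p [:- a, 1:])" "j < dim_col (mult_mod_mat p [:- a, 1:])"
  then have ij: "i < degree p" "j < degree p" by (simp_all add: mult_mod_mat_def)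
  have low: "monom 1 i mod p = monom 1 i"
    using ij by (simp add: mod_poly_less degree_monom_eq)
  have up: "coeff (monom 1 (Suc i) mod p) j = companion_mat p $$ (i, j)"
  proof (cases "Suc i = degree p")
    case True
    have "monom 1 (degree p) - p = 0 \<or> degree (monom 1 (degree p) - p) < degree p"
    proof -
      have "degree (monom 1 (degree p) - p) \<le> degree p"
        by (intro degree_diff_le) (simp_all add: degree_monom_le)
      moreover have "coeff (monom 1 (degree p) - p) (degree p) = 0"
        using \<open>monic p\<close> by simp
      ultimately show ?thesis
        by (metis le_neq_implies_less leading_coeff_0_iff)
    qed
    then have "(monom 1 (degree p) - p) mod p = monom 1 (degree p) - p"
      by (metis mod_0 mod_poly_less)
    then have "monom 1 (Suc i) mod p = monom 1 (degree p) - p"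
      using True by (metis minus_mod_self2)
    then show ?thesis
      using ij True by (simp add: companion_mat_def)
  next
    case False
    then have "monom 1 (Suc i) mod p = monom 1 (Suc i)"
      using ij by (simp add: mod_poly_less degree_monom_eq)
    then show ?thesis
      using ij False by (simp add: companion_mat_def)
  qed
  have "monom 1 i * [:- a, 1:] = monom 1 (Suc i) - Polynomial.smult a (monom 1 i)"
    by (simp add: monom_Suc mult.commute[of "monom 1 i"] )
  then have "coeff ((monom 1 i * [:- a, 1:]) mod p) j
      = coeff (monom 1 (Suc i) mod p) j - a * coeff (monom 1 i mod p) j"
    by (simp add: poly_mod_diff_left mod_smult_left)
  then show "(companion_mat p - a \<cdot>\<^sub>m 1\<^sub>m (degree p)) $$ (i, j) = mult_mod_mat p [:- a, 1:] $$ (i, j)"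
    using ij unfolding up low by (simp add: mult_mod_mat_def companion_mat_def)
qed (simp_all add: mult_mod_mat_def companion_mat_def)

text \<open>
  The eigenvector is \<open>(1, z, z\<^sup>2, \<dots>)\<close>.
\<close>
lemma companion_mat_root_eigenvalue:
  assumes "monic p" and "degree p > 0" and "poly p z = 0"
  shows "eigenvalue (companion_mat p) z"
proof -
  define n where "n = degree p"
  define v where "v = vec n (\<lambda>i. z ^ i)"
  have A: "companion_mat p \<in> carrier_mat n n" by (simp add: companion_mat_def n_def)
  have "companion_mat p *\<^sub>v v = z \<cdot>\<^sub>v v"
  proof (rule eq_vecI)
    fix i assume "i < dim_vec (z \<cdot>\<^sub>v v)"
    then have i: "i < n" by (simp add: v_def)
    have "vec_index (companion_mat p *\<^sub>v v) i = (\<Sum>j<n. companion_mat p $$ (i, j) * z ^ j)"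
      using i by (simp add: companion_mat_def n_def v_def scalar_prod_def lessThan_atLeast0)
    also have "\<dots> = z ^ Suc i"
    proof (cases "Suc i = n")
      case True
      have "0 = (\<Sum>j\<le>n. coeff p j * z ^ j)"
        using assms(3) by (simp add: poly_altdef n_def)
      also have "\<dots> = (\<Sum>j<n. coeff p j * z ^ j) + z ^ n"
        using \<open>monic p\<close> by (simp add: n_def flip: lessThan_Suc_atMost)
      finally show ?thesis
        using True i by (simp add: companion_mat_def n_def sum_negf neg_eq_iff_add_eq_0 add.commute)
    next
      case False
      have "(\<Sum>j<n. companion_mat p $$ (i, j) * z ^ j) = (\<Sum>j<n. if j = Suc i then z ^ j else 0)"
        using i False by (intro sum.cong refl) (auto simp: companion_mat_def n_def)
      then show ?thesis using i False by simp
    qed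
    finally show "vec_index (companion_mat p *\<^sub>v v) i = vec_index (z \<cdot>\<^sub>v v) i"
      using i by (simp add: v_def)
  qed (simp add: companion_mat_def n_def v_def)
  moreover have "v \<noteq> 0\<^sub>v n"
  proof
    assume "v = 0\<^sub>v n"
    then have "vec_index v 0 = vec_index (0\<^sub>v n) 0" by simp
    then show False using assms(2) by (simp add: v_def n_def)
  qed
  ultimately show ?thesis
    using A unfolding eigenvalue_def eigenvector_def by (auto simp: v_def intro!: exI[of _ v])
qed

lemma poly_taylor_quadratic:
  fixes q :: "complex poly"
  obtains h where "q = [:poly q a:] + Polynomial.smult (poly (pderiv q) a) [:- a, 1:] + [:- a, 1:] ^ 2 * h"
proof -
  have "[:- a, 1:] dvd q - [:poly q a:]"
    by (simp add: dvd_iff_poly_eq_0)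
  then obtain h1 where "q - [:poly q a:] = [:- a, 1:] * h1" ..
  then have q: "q = [:poly q a:] + [:- a, 1:] * h1" by (simp add: algebra_simps)
  have "[:- a, 1:] dvd h1 - [:poly h1 a:]"
    by (simp add: dvd_iff_poly_eq_0)
  then obtain h2 where "h1 - [:poly h1 a:] = [:- a, 1:] * h2" ..
  then have h1: "h1 = [:poly h1 a:] + [:- a, 1:] * h2" by (simp add: algebra_simps)
  have "pderiv q = h1 + [:- a, 1:] * pderiv h1"
    by (subst q) (simp only: pderiv_add pderiv_mult pderiv_pCons, simp)
  then have "poly (pderiv q) a = poly h1 a" by simp
  moreover have "q = [:poly q a:] + Polynomial.smult (poly h1 a) [:- a, 1:] + [:- a, 1:] ^ 2 * h2"
  proof -
    define L where "L = [:- a, 1:]"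
    have "q = [:poly q a:] + L * ([:poly h1 a:] + L * h2)"
      using q h1 unfolding L_def by metis
    then have "q = [:poly q a:] + Polynomial.smult (poly h1 a) L + L ^ 2 * h2"
      by (simp add: power2_eq_square distrib_left mult.assoc add.assoc)
    then show ?thesis by (simp only: L_def)
  qed
  ultimately show ?thesis using that by metis
qed

text \<open>
  Only the part of the Taylor expansion of \<open>q\<close> at \<open>a\<close> below order two (or one) survives modulo
  \<open>L\<^bsup>m+2\<^esup>\<close>.  For \<open>q = x\<^sup>i\<close> these remainders are the rows of \<open>(A - a)\<^bsup>m+1\<^esup>\<close> and \<open>(A - a)\<^bsup>m\<^esup>\<close>, where \<open>A\<close> is
  the companion matrix of \<open>L\<^bsup>m+2\<^esup>\<close>.
\<close>
lemma mult_linear_power_mod: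
  fixes q :: "complex poly" and a :: complex
  defines "L \<equiv> [:- a, 1:]"
  shows "(q * L ^ Suc m) mod L ^ Suc (Suc m) = Polynomial.smult (poly q a) (L ^ Suc m)"
    and "(q * L ^ m) mod L ^ Suc (Suc m)
      = Polynomial.smult (poly q a) (L ^ m) + Polynomial.smult (poly (pderiv q) a) (L ^ Suc m)"
proof -
  have deg: "degree (L ^ k) = k" for k
    by (simp add: L_def degree_linear_power)
  obtain h where q: "q = [:poly q a:] + Polynomial.smult (poly (pderiv q) a) L + L ^ 2 * h"
    unfolding L_def by (rule poly_taylor_quadratic)
  define r where "r = Polynomial.smult (poly q a) (L ^ m) + Polynomial.smult (poly (pderiv q) a) (L ^ Suc m)"
  have "q * L ^ m = r + h * L ^ Suc (Suc m)"
    by (subst q) (simp add: r_def algebra_simps power2_eq_square)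
  moreover have "degree r < degree (L ^ Suc (Suc m))"
    unfolding r_def deg
    by (intro degree_add_less le_less_trans[OF degree_smult_le]) (simp_all only: deg)
  ultimately show "(q * L ^ m) mod L ^ Suc (Suc m) = r"
    by (simp add: mod_poly_less del: power_Suc)
  define r' where "r' = Polynomial.smult (poly q a) (L ^ Suc m)"
  have "q * L ^ Suc m = r' + (Polynomial.smult (poly (pderiv q) a) 1 + L * h) * L ^ Suc (Suc m)"
    by (subst q) (simp add: r'_def algebra_simps power2_eq_square)
  moreover have "degree r' < degree (L ^ Suc (Suc m))"
    unfolding r'_def deg
    by (intro le_less_trans[OF degree_smult_le]) (simp only: deg)
  ultimately show "(q * L ^ Suc m) mod L ^ Suc (Suc m) = r'"
    by (simp add: mod_poly_less del: power_Suc)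
qed

section \<open>The two traces for a single eigenvalue\<close>

text \<open>
  The pairing of \<open>A - a\<close> with the rank one matrix \<open>w f\<^sup>T\<close>: the superdiagonal, the last row and the
  shift by \<open>a\<close> contribute one term each.  The relevant powers of \<open>A - a\<close> are sums of at most two such
  rank one matrices.
\<close>
lemma weighted_companion_sum:
  fixes p f :: "complex poly" and w :: "nat \<Rightarrow> complex"
  assumes "degree p = Suc m"
  shows "(\<Sum>i<Suc m. \<Sum>j<Suc m.
      cnj ((companion_mat p - a \<cdot>\<^sub>m 1\<^sub>m (Suc m)) $$ (i, j)) * (w i * coeff f j))
    = (\<Sum>i<m. w i * coeff f (Suc i)) - w m * (\<Sum>j<Suc m. coeff f j * cnj (coeff p j))
      - cnj a * (\<Sum>i<Suc m. w i * coeff f i)" (is "?lhs = _")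
proof -
  let ?A = "companion_mat p"
  have A: "?A \<in> carrier_mat (Suc m) (Suc m)" using assms by (simp add: companion_mat_def)
  have "?lhs = (\<Sum>i<Suc m. (\<Sum>j<Suc m. cnj (?A $$ (i, j)) * (w i * coeff f j))
      - (\<Sum>j<Suc m. if i = j then cnj a * (w i * coeff f j) else 0))"
    unfolding sum_subtractf[symmetric]
    by (intro sum.cong refl) (use A in \<open>auto simp: algebra_simps\<close>)
  also have "\<dots> = (\<Sum>i<Suc m. \<Sum>j<Suc m. cnj (?A $$ (i, j)) * (w i * coeff f j))
      - cnj a * (\<Sum>i<Suc m. w i * coeff f i)"
    unfolding sum_subtractf sum_distrib_left
    by (intro arg_cong2[of _ _ _ _ "(-)"] sum.cong refl) (simp del: sum.lessThan_Suc)
  also have "(\<Sum>i<Suc m. \<Sum>j<Suc m. cnj (?A $$ (i, j)) * (w i * coeff f j))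
      = (\<Sum>i<m. \<Sum>j<Suc m. cnj (?A $$ (i, j)) * (w i * coeff f j))
        + (\<Sum>j<Suc m. cnj (?A $$ (m, j)) * (w m * coeff f j))"
    by (rule sum.lessThan_Suc)
  also have "(\<Sum>i<m. \<Sum>j<Suc m. cnj (?A $$ (i, j)) * (w i * coeff f j))
      = (\<Sum>i<m. w i * coeff f (Suc i))"
  proof (intro sum.cong refl)
    fix i assume "i \<in> {..<m}"
    then have i: "i < m" by simp
    have "(\<Sum>j<Suc m. cnj (?A $$ (i, j)) * (w i * coeff f j))
        = (\<Sum>j<Suc m. if j = Suc i then w i * coeff f j else 0)"
      using i assms by (intro sum.cong refl) (auto simp: companion_mat_def)
    also have "\<dots> = w i * coeff f (Suc i)"
      using i by (simp del: sum.lessThan_Suc)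
    finally show "(\<Sum>j<Suc m. cnj (?A $$ (i, j)) * (w i * coeff f j)) = w i * coeff f (Suc i)" .
  qed
  also have "(\<Sum>j<Suc m. cnj (?A $$ (m, j)) * (w m * coeff f j))
      = - (w m * (\<Sum>j<Suc m. coeff f j * cnj (coeff p j)))"
    unfolding sum_distrib_left sum_negf[symmetric]
    by (intro sum.cong refl) (use assms in \<open>simp add: companion_mat_def\<close>)
  finally show ?thesis by simp
qed

lemma poly_eq_sum_lessThan:
  fixes f :: "complex poly"
  assumes "degree f \<le> m"
  shows "poly f a = (\<Sum>i<Suc m. a ^ i * coeff f i)"
    and "poly (pderiv f) a = (\<Sum>i<Suc m. (of_nat i * a ^ (i - 1)) * coeff f i)"
proof -
  have f: "f = (\<Sum>i\<le>m. monom (coeff f i) i)"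
    using poly_as_sum_of_monoms'[OF assms] by simp
  show "poly f a = (\<Sum>i<Suc m. a ^ i * coeff f i)"
    by (subst f) (simp add: poly_sum poly_monom mult.commute lessThan_Suc_atMost)
  show "poly (pderiv f) a = (\<Sum>i<Suc m. (of_nat i * a ^ (i - 1)) * coeff f i)"
    by (subst f) (simp add: pderiv_sum pderiv_monom poly_sum poly_monom mult_ac lessThan_Suc_atMost)
qed

text \<open>
  The superdiagonal contributions for the weights \<open>a\<^sup>i\<close> and \<open>i a\<^bsup>i-1\<^esup>\<close> are values of \<open>(f - f(0)) / x\<close>
  and of its derivative at \<open>a\<close>, here cleared of denominators.
\<close>
lemma shifted_sums:
  fixes f :: "complex poly"
  assumes "degree f \<le> m"
  shows "a * (\<Sum>i<m. a ^ i * coeff f (Suc i)) = poly f a - coeff f 0"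
    and "a\<^sup>2 * (\<Sum>i<m. (of_nat i * a ^ (i - 1)) * coeff f (Suc i))
      = a * poly (pderiv f) a - poly f a + coeff f 0"
proof -
  have s: "(\<Sum>i<m. a ^ Suc i * coeff f (Suc i)) = poly f a - coeff f 0"
    unfolding poly_eq_sum_lessThan(1)[OF assms] sum.lessThan_Suc_shift by simp
  then show "a * (\<Sum>i<m. a ^ i * coeff f (Suc i)) = poly f a - coeff f 0"
    by (simp add: sum_distrib_left mult.assoc)
  have d: "a * poly (pderiv f) a = (\<Sum>i<m. of_nat (Suc i) * a ^ Suc i * coeff f (Suc i))"
    unfolding poly_eq_sum_lessThan(2)[OF assms] sum.lessThan_Suc_shift
    by (simp add: sum_distrib_left mult_ac)
  have "a\<^sup>2 * (of_nat i * a ^ (i - 1)) = of_nat i * a ^ Suc i" for i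
    by (cases i) (simp_all add: power2_eq_square)
  then have "a\<^sup>2 * (\<Sum>i<m. (of_nat i * a ^ (i - 1)) * coeff f (Suc i))
      = (\<Sum>i<m. of_nat i * a ^ Suc i * coeff f (Suc i))"
    unfolding sum_distrib_left by (metis (no_types, lifting) mult.assoc)
  also have "\<dots> = (\<Sum>i<m. of_nat (Suc i) * a ^ Suc i * coeff f (Suc i)) - (\<Sum>i<m. a ^ Suc i * coeff f (Suc i))"
    unfolding sum_subtractf[symmetric] by (intro sum.cong refl) (simp add: algebra_simps)
  finally show "a\<^sup>2 * (\<Sum>i<m. (of_nat i * a ^ (i - 1)) * coeff f (Suc i))
      = a * poly (pderiv f) a - poly f a + coeff f 0"
    unfolding s d[symmetric] by simp
qed

text \<open>
  The factor \<open>(- a)\<^sup>d\<close> makes the powers of \<open>- a\<close> and \<open>- cnj a\<close> agree in every summand; the sum thereby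
  becomes real and nonnegative.
\<close>
lemma linear_power_inner_product:
  fixes a :: complex
  defines "L \<equiv> [:- a, 1:]"
  assumes "k + d = n"
  shows "(- a) ^ d * (\<Sum>j<n. coeff (L ^ k) j * cnj (coeff (L ^ n) j))
    = of_real (\<Sum>j<n. real (k choose j) * real (n choose j) * (cmod a)\<^sup>2 ^ (n - j))"
proof -
  have "(- a) ^ d * (coeff (L ^ k) j * cnj (coeff (L ^ n) j))
      = of_real (real (k choose j) * real (n choose j) * (cmod a)\<^sup>2 ^ (n - j))" if "j < n" for j
  proof (cases "j \<le> k")
    case True
    have "(- a) ^ d * (- a) ^ (k - j) * cnj ((- a) ^ (n - j)) = of_real ((cmod a)\<^sup>2 ^ (n - j))"
    proof -
      have "n - j = d + (k - j)" using True assms by simp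
      then have "(- a) ^ d * (- a) ^ (k - j) * cnj ((- a) ^ (n - j)) = (- a) ^ (n - j) * cnj ((- a) ^ (n - j))"
        by (simp only: power_add)
      also have "\<dots> = (- a * cnj (- a)) ^ (n - j)"
        by (simp only: complex_cnj_power power_mult_distrib)
      also have "- a * cnj (- a) = of_real ((cmod a)\<^sup>2)"
        by (simp only: complex_norm_square[symmetric] norm_minus_cancel)
      finally show ?thesis by simp
    qed
    moreover have "coeff (L ^ k) j = of_nat (k choose j) * (- a) ^ (k - j)"
      using coeff_linear_poly_power[OF True, of "- a" 1] by (simp add: L_def)
    moreover have "coeff (L ^ n) j = of_nat (n choose j) * (- a) ^ (n - j)"
      using coeff_linear_poly_power[of j n "- a" 1] \<open>j < n\<close> by (simp add: L_def)
    ultimately show ?thesis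
      by (simp only: complex_cnj_mult complex_cnj_of_nat of_real_mult of_real_of_nat_eq mult_ac)
  next
    case False
    then have "coeff (L ^ k) j = 0"
      by (intro coeff_eq_0) (simp add: L_def degree_linear_power)
    then show ?thesis using False by simp
  qed
  then show ?thesis
    unfolding sum_distrib_left of_real_sum by (intro sum.cong refl) simp
qed

text \<open>
  With \<open>e = (-1)\<^bsup>n-1\<^esup>\<close> the trace conditions evaluate to \<open>S (n - 1) = e\<close> and \<open>S (n - 2) = (n + 1) e\<close>,
  but \<open>S\<close> is nonnegative and increasing.
\<close>
lemma companion_traces_contradiction:
  fixes a :: complex and n :: nat
  defines "L \<equiv> [:- a, 1:]"
  defines "B \<equiv> companion_mat (L ^ n) - a \<cdot>\<^sub>m 1\<^sub>m n"
  assumes "n > 3" and "a \<noteq> 0"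
    and traces: "\<And>k. k < 2 \<Longrightarrow>
      (\<Sum>i<n. \<Sum>j<n. cnj (B $$ (i, j)) * (B ^\<^sub>m (n - 1 - k)) $$ (i, j)) = 0"
  shows False
proof -
  obtain m where n: "n = Suc (Suc m)" and m: "m \<ge> 2"
    using \<open>n > 3\<close> by (metis Suc_le_D Suc_leD Suc_le_mono eval_nat_numeral(2,3) less_eq_Suc_le numeral_2_eq_2 numeral_3_eq_3)
  define p where "p = L ^ n"
  define f1 where "f1 = L ^ Suc m"
  define f2 where "f2 = L ^ m"
  have deg: "degree (L ^ k) = k" for k
    by (simp add: L_def degree_linear_power)
  have mon: "coeff (L ^ k) k = 1" for k
    using monic_power[of L k] unfolding deg by (simp add: L_def)
  have p: "degree p = n" "monic p" by (simp_all only: p_def deg mon)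
  have root: "poly L a = 0" "pderiv L = 1"
    by (simp_all add: L_def pderiv_pCons)
  have f1: "degree f1 \<le> Suc m" "poly f1 a = 0" "poly (pderiv f1) a = 0" "coeff f1 0 = (- a) ^ Suc m"
  proof -
    show "degree f1 \<le> Suc m" by (simp only: f1_def deg)
    show "poly f1 a = 0" by (simp add: f1_def root)
    have "pderiv f1 = Polynomial.smult (of_nat (Suc m)) (L ^ m)"
      unfolding f1_def pderiv_power_Suc by (simp add: root)
    then show "poly (pderiv f1) a = 0" using m by (simp add: root)
    have "poly f1 0 = (- a) ^ Suc m" unfolding f1_def poly_power by (simp add: L_def)
    then show "coeff f1 0 = (- a) ^ Suc m" by (simp only: poly_0_coeff_0)
  qed
  have f2: "degree f2 \<le> Suc m" "poly f2 a = 0" "coeff f2 0 = (- a) ^ m"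
  proof -
    show "degree f2 \<le> Suc m" unfolding f2_def deg by simp
    show "poly f2 a = 0" using m by (simp add: f2_def root)
    have "poly f2 0 = (- a) ^ m" unfolding f2_def poly_power by (simp add: L_def)
    then show "coeff f2 0 = (- a) ^ m" by (simp only: poly_0_coeff_0)
  qed
  have Bpow: "(B ^\<^sub>m k) $$ (i, j) = coeff ((monom 1 i * L ^ k) mod L ^ Suc (Suc m)) j"
    if "i < n" "j < n" for i j k
  proof -
    have "B = mult_mod_mat p L"
      using companion_mat_shift[of p a] p unfolding B_def p_def[symmetric] L_def[symmetric] by (simp add: n)
    then have "B ^\<^sub>m k = mult_mod_mat p (L ^ k)"
      using mult_mod_mat_power[of p L k] p by (simp add: n)
    then have "(B ^\<^sub>m k) $$ (i, j) = coeff ((monom 1 i * L ^ k) mod p) j"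
      using that p by (simp add: mult_mod_mat_def)
    then show ?thesis by (simp only: p_def n)
  qed
  have row1: "(B ^\<^sub>m Suc m) $$ (i, j) = a ^ i * coeff f1 j" if "i < n" "j < n" for i j
    unfolding Bpow[OF that] f1_def mult_linear_power_mod(1)[of _ a m, folded L_def]
    by (simp add: poly_monom del: power_Suc)
  have row2: "(B ^\<^sub>m m) $$ (i, j) = a ^ i * coeff f2 j + (of_nat i * a ^ (i - 1)) * coeff f1 j"
    if "i < n" "j < n" for i j
    unfolding Bpow[OF that] f1_def f2_def mult_linear_power_mod(2)[of _ a m, folded L_def]
    by (simp add: poly_monom pderiv_monom del: power_Suc)
  define T1 where "T1 = (\<Sum>j<n. coeff f1 j * cnj (coeff p j))"
  define T2 where "T2 = (\<Sum>j<n. coeff f2 j * cnj (coeff p j))"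
  define w0 where "w0 = (\<lambda>i. a ^ i)"
  define w1 where "w1 = (\<lambda>i. of_nat i * a ^ (i - 1) :: complex)"
  \<comment> \<open>Each trace is a combination of the pairings \<open>E w f\<close>: the first is \<open>E w0 f1\<close>, the second
    \<open>E w0 f2 + E w1 f1\<close>.\<close>
  define E where "E = (\<lambda>w f. \<Sum>i<n. \<Sum>j<n. cnj (B $$ (i, j)) * (w i * coeff f j))"
  have E: "E w f = (\<Sum>i<Suc m. w i * coeff f (Suc i))
      - w (Suc m) * (\<Sum>j<n. coeff f j * cnj (coeff p j)) - cnj a * (\<Sum>i<n. w i * coeff f i)" for w f
    unfolding E_def B_def p_def n by (rule weighted_companion_sum) (rule deg)
  have E01: "a * E w0 f1 = - ((- a) ^ Suc m) - a * a ^ Suc m * T1"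
  proof -
    have "(\<Sum>i<n. w0 i * coeff f1 i) = 0"
      using poly_eq_sum_lessThan(1)[OF f1(1), of a] f1(2) by (simp add: w0_def n)
    then have "E w0 f1 = (\<Sum>i<Suc m. w0 i * coeff f1 (Suc i)) - w0 (Suc m) * T1"
      unfolding E T1_def by (simp only: mult_zero_right diff_zero)
    then show ?thesis
      using shifted_sums(1)[OF f1(1), of a] f1 unfolding w0_def
      by (simp only: right_diff_distrib mult.assoc diff_0)
  qed
  have E02: "a * E w0 f2 = - ((- a) ^ m) - a * a ^ Suc m * T2"
  proof -
    have "(\<Sum>i<n. w0 i * coeff f2 i) = 0"
      using poly_eq_sum_lessThan(1)[OF f2(1), of a] f2(2) by (simp add: w0_def n)
    then have "E w0 f2 = (\<Sum>i<Suc m. w0 i * coeff f2 (Suc i)) - w0 (Suc m) * T2"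
      unfolding E T2_def by (simp only: mult_zero_right diff_zero)
    then show ?thesis
      using shifted_sums(1)[OF f2(1), of a] f2 unfolding w0_def
      by (simp only: right_diff_distrib mult.assoc diff_0)
  qed
  have E11: "a\<^sup>2 * E w1 f1 = (- a) ^ Suc m - a\<^sup>2 * (of_nat (Suc m) * a ^ m) * T1"
  proof -
    have "(\<Sum>i<n. w1 i * coeff f1 i) = 0"
      using poly_eq_sum_lessThan(2)[OF f1(1), of a] f1(3) by (simp add: w1_def n)
    then have "E w1 f1 = (\<Sum>i<Suc m. w1 i * coeff f1 (Suc i)) - w1 (Suc m) * T1"
      unfolding E T1_def by (simp only: mult_zero_right diff_zero)
    then show ?thesis
      using shifted_sums(2)[OF f1(1), of a] f1 unfolding w1_def
      by (simp only: right_diff_distrib mult.assoc mult_zero_right diff_0_right add_0 diff_Suc_1)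
  qed
  have "E w0 f1 = 0"
    using traces[of 0] unfolding E_def w0_def by (simp add: n row1 del: sum.lessThan_Suc pow_mat.simps)
  have "E w0 f2 + E w1 f1 = 0"
    using traces[of 1] unfolding E_def w0_def w1_def
    by (simp add: n row2 distrib_left sum.distrib del: sum.lessThan_Suc pow_mat.simps)
  define S where "S = (\<lambda>k. \<Sum>j<n. real (k choose j) * real (n choose j) * (cmod a)\<^sup>2 ^ (n - j))"
  have S1: "a * T1 = - of_real (S (Suc m))"
    using linear_power_inner_product[of "Suc m" 1 n a] n
    unfolding T1_def f1_def p_def S_def L_def by (simp add: eq_neg_iff_add_eq_0 add.commute minus_equation_iff del: power_Suc sum.lessThan_Suc)
  have S2: "a\<^sup>2 * T2 = of_real (S m)"
    using linear_power_inner_product[of m 2 n a] n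
    unfolding T2_def f2_def p_def S_def L_def by (simp del: power_Suc sum.lessThan_Suc)
  define e :: real where "e = (- 1) ^ Suc m"
  have e: "(- a) ^ Suc m = of_real e * a ^ Suc m"
    by (simp add: e_def power_minus[of a])
  have eq1: "S (Suc m) = e"
  proof -
    have "0 = - (of_real e * a ^ Suc m) - a ^ Suc m * (a * T1)"
      using E01 \<open>E w0 f1 = 0\<close> unfolding e by (simp only: mult_zero_left mult_zero_right mult_ac)
    also have "\<dots> = a ^ Suc m * of_real (S (Suc m) - e)"
      unfolding S1 by (simp add: algebra_simps)
    finally show ?thesis using \<open>a \<noteq> 0\<close> by simp
  qed
  have eq2: "S m = (real m + 3) * e"
  proof -
    have "0 = a * (a * E w0 f2) + a\<^sup>2 * E w1 f1"
      using \<open>E w0 f2 + E w1 f1 = 0\<close> by (simp add: power2_eq_square mult.assoc flip: distrib_left)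
    also have "\<dots> = 2 * (- a) ^ Suc m - a ^ Suc m * (a\<^sup>2 * T2) - of_nat (Suc m) * a ^ Suc m * (a * T1)"
      unfolding E02 E11 by (simp add: algebra_simps power2_eq_square)
    also have "\<dots> = a ^ Suc m * of_real (2 * e - S m + real (Suc m) * S (Suc m))"
      unfolding S1 S2 e by (simp add: algebra_simps)
    finally have "2 * e - S m + real (Suc m) * S (Suc m) = 0"
      using \<open>a \<noteq> 0\<close> by (metis mult_eq_0_iff of_real_eq_0_iff power_not_zero)
    then show ?thesis unfolding eq1 by (simp add: algebra_simps)
  qed
  have "S (Suc m) \<ge> 0"
    unfolding S_def by (intro sum_nonneg) simp
  then have "e = 1"
    using eq1 by (cases "even m") (auto simp: e_def)
  have "m choose j \<le> Suc m choose j" for j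
    by (cases j) simp_all
  then have "S m \<le> S (Suc m)"
    unfolding S_def by (intro sum_mono mult_right_mono) simp_all
  then show False
    using eq1 eq2 \<open>e = 1\<close> by simp
qed

section \<open>Disks force the Jordan block\<close>

theorem theorem4p2:
  fixes n :: nat and a :: complex and p :: "complex poly" and A :: "complex mat"
  assumes "n > 3"
    and "monic p" and "degree p = n"
    and "A = companion_mat p"
    and "spectrum A = {a}"
    and "circular_disk (numerical_range A)"
  shows "a = 0 \<and> A = jordan_block n 0"
proof -
  have A: "A \<in> carrier_mat n n"
    using assms by (simp add: companion_mat_def)
  have ev: "z = a" if "eigenvalue A z" for z
    using that \<open>spectrum A = {a}\<close> by (auto simp: spectrum_def)
  have p: "p = [:- a, 1:] ^ n"
    using monic_complex_poly_single_root[of p a] companion_mat_root_eigenvalue[of p] ev assms by auto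
  obtain c r where "r > 0" and W: "numerical_range A = cball c r"
    using \<open>circular_disk (numerical_range A)\<close> unfolding circular_disk_def by blast
  have "c = a"
    by (rule ev, rule disk_numerical_range_center_eigenvalue[OF A \<open>r > 0\<close> W])
  define B where "B = A - a \<cdot>\<^sub>m 1\<^sub>m n"
  have B: "B \<in> carrier_mat n n" unfolding B_def by (intro minus_carrier_mat) simp
  define Q where "Q = mat n n (\<lambda>(i, j). cnj (B $$ (j, i)) / (4 * of_real r ^ 2))"
  have "B ^\<^sub>m n = 0\<^sub>m n n"
  proof -
    have "B = mult_mod_mat p [:- a, 1:]"
      using companion_mat_shift[of p a] assms by (simp add: B_def)
    then have "B ^\<^sub>m n = mult_mod_mat p p"
      using mult_mod_mat_power[of p "[:- a, 1:]" n] assms p by simp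
    also have "\<dots> = 0\<^sub>m n n"
      using \<open>degree p = n\<close> by (intro eq_matI) (simp_all add: mult_mod_mat_def)
    finally show ?thesis .
  qed
  moreover have "det (mat n n (\<lambda>(i, j). char_poly_matrix B $$ (i, j) - [:0, 0, Q $$ (i, j):])) = 0"
  proof -
    have "mat n n (\<lambda>(i, j). char_poly_matrix B $$ (i, j) - [:0, 0, Q $$ (i, j):])
      = mat n n (\<lambda>(i, j). [:(c \<cdot>\<^sub>m 1\<^sub>m n - A) $$ (i, j), if i = j then 1 else 0,
          cnj ((c \<cdot>\<^sub>m 1\<^sub>m n - A) $$ (j, i)) / (4 * of_real r ^ 2):])"
      by (rule cong_mat)
        (use A B in \<open>auto simp: char_poly_matrix_def Q_def B_def \<open>c = a\<close> one_pCons diff_divide_distrib\<close>)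
    then show ?thesis
      using disk_numerical_range_pencil[OF A \<open>r > 0\<close> W] by simp
  qed
  ultimately have tr: "(\<Sum>i<n. \<Sum>j<n. Q $$ (i, j) * (B ^\<^sub>m (n - 1 - k)) $$ (j, i)) = 0" if "k < 2" for k
    using that \<open>n > 3\<close> B by (intro nilpotent_pencil_traces) (auto simp: Q_def)
  have "(\<Sum>i<n. \<Sum>j<n. cnj (B $$ (i, j)) * (B ^\<^sub>m (n - 1 - k)) $$ (i, j)) = 0" if "k < 2" for k
  proof -
    have "(\<Sum>i<n. \<Sum>j<n. cnj (B $$ (i, j)) * (B ^\<^sub>m (n - 1 - k)) $$ (i, j))
        = (\<Sum>j<n. \<Sum>i<n. cnj (B $$ (i, j)) * (B ^\<^sub>m (n - 1 - k)) $$ (i, j))"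
      by (rule sum.swap)
    also have "\<dots> = 4 * of_real r ^ 2 *
        (\<Sum>i<n. \<Sum>j<n. Q $$ (i, j) * (B ^\<^sub>m (n - 1 - k)) $$ (j, i))"
      unfolding sum_distrib_left
      by (intro sum.cong refl) (use \<open>r > 0\<close> in \<open>simp add: Q_def\<close>)
    finally show ?thesis using tr[OF that] by simp
  qed
  then have "a = 0"
    using companion_traces_contradiction[of n a] \<open>n > 3\<close>
    unfolding B_def \<open>A = companion_mat p\<close> p by blast
  moreover have "companion_mat ([:0, 1:] ^ n) = (jordan_block n 0 :: complex mat)"
  proof -
    have "[:0, 1:] ^ n = (monom 1 n :: complex poly)" by (simp add: monom_altdef)
    moreover have "degree (monom 1 n :: complex poly) = n" by (simp add: degree_monom_eq)
    ultimately show ?thesis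
      by (intro eq_matI) (auto simp: companion_mat_def jordan_block_def)
  qed
  ultimately show ?thesis
    using p \<open>A = companion_mat p\<close> by simp
qed

end
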